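(* Let $m,n\in\mathbb{N}$, $0\le a\le n$, $0\le b\le m$ be integers. Then the dual (with respect to $m,n$) of $V_{a,b}\cap R_{n,m}$ is $R_{n-a,m-b}$. Consequently, for the family $\mathcal{F}=\{S_{a,b}\}$ consisting of a single double star, $$\mathrm{ex}(m,n,\mathcal{F})=mn-\gamma(R_{n-a,m-b},m,n),$$ where, for $a\le n-1$ and $b\le m-1$, $$\gamma(R_{n-a,m-b},m,n)=\min_{\substack{m-b\le x\le m\\ n-a\le y\le n}}\bigl((m-x)(n-y)+\max((n-a)x,(m-b)y)\bigr)$$ with $x,y$ ranging over integers.
   Context: $\mathbb{Z}_+=\{0,1,2,\dots\}$, $\mathbb{N}=\{1,2,\dots\}$, $[0,c]=\{0,\dots,c\}$, $R_{a,b}=[0,a-1]\times[0,b-1]$ (empty if $a=0$ or $b=0$). A zero-set (or Young diagram) is a downward-closed subset of $\mathbb{Z}_+^2$. For integers $a,b\ge0$, $V_{a,b}=\mathbb{Z}_+^2\setminus\{(x,y)\colon x\ge a,\ y\ge b\}$. Young domination: the graph $K_m\Box K_n$ is represented on the vertex set $R_{n,m}=[0,n-1]\times[0,m-1]$, two vertices being adjacent iff they differ in exactly one coordinate. For $v=(j,i)\in R_{n,m}$, $\mathcal{N}^r(v)$ is the set of all $(j',i)\in R_{n,m}$ with $j'\ne j$ and $\mathcal{N}^c(v)$ the set of all $(j,i')\in R_{n,m}$ with $i'\neq i$. For a zero-set $\mathcal{Z}$, $\mathcal{T}(A)=A\cup\{v\in R_{n,m}\setminus A\colon (|\mathcal{N}^r(v)\cap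 A|,|\mathcal{N}^c(v)\cap A|)\notin\mathcal{Z}\}$ and $\gamma(\mathcal{Z},m,n)=\min\{|A|\colon A\subseteq R_{n,m},\ \mathcal{T}(A)=R_{n,m}\}$. Duality: a convex corner of a Young diagram $\mathcal{Y}$ is a maximal point of $\mathcal{Y}$ in the coordinatewise order; a concave corner is a minimal point of $\mathbb{Z}_+^2\setminus\mathcal{Y}$; $\mathcal{I}_{\mathcal{Y}}$ is the set of concave corners. For a Young diagram $\mathcal{Y}\subseteq R_{n,m}$, its dual is the unique Young diagram $\check{\mathcal{Y}}\subseteq R_{n,m}$ whose set of convex corners is $\{(n-a-1,m-b-1)\colon (a,b)\in\mathcal{I}_{\mathcal{Y}},\ 0\le a\le n-1,\ 0\le b\le m-1\}$. Double stars: for integers $p,q\ge0$, $S_{p,q}$ is obtained from disjoint $K_{1,p}$ and $K_{1,q}$ by adding an edge between the center $u$ of $K_{1,p}$ and the center $v$ of $K_{1,q}$ (so $u$ has degree $p+1$ and $v$ degree $q+1$); it is equipped with the bipartition $(X_{p,q},Y_{p,q})$ with $u\in X_{p,q}$, $v\in Y_{p,q}$. For a family $\mathcal{F}$ of double stars, $\mathrm{ex}(m,n,\mathcal{F})$ is the maximum number of edges in a bipartite graph with bipartition $(X,Y)$, $|X|=m$, $|Y|=n$, that contains no $S_{p,q}\in\mathcal{F}$ as a (not necessarily induced) subgraph respecting the bipartitions (with $X_{p,q}$ inside $X$ and $Y_{p,q}$ inside $Y$). *)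

theory Defs
  imports Main "HOL-Library.Product_Order"
begin

text \<open>
  Subsets of \<open>nat \<times> nat\<close>; the order on points is the coordinatewise one from
  \<^theory>\<open>HOL-Library.Product_Order\<close>.
\<close>

definition young_diagram :: "(nat \<times> nat) set \<Rightarrow> bool" where
  "young_diagram Z \<longleftrightarrow> (\<forall>v\<in>Z. \<forall>w. w \<le> v \<longrightarrow> w \<in> Z)"

definition Rect :: "nat \<Rightarrow> nat \<Rightarrow> (nat \<times> nat) set" where
  "Rect a b = {0..<a} \<times> {0..<b}"

definition Vset :: "nat \<Rightarrow> nat \<Rightarrow> (nat \<times> nat) set" where
  "Vset a b = UNIV - {(x, y). a \<le> x \<and> b \<le> y}"

definition row_nbrs :: "nat \<Rightarrow> nat \<Rightarrow> nat \<times> nat \<Rightarrow> (nat \<times> nat) set" where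
  "row_nbrs m n v = {w \<in> Rect n m. snd w = snd v \<and> fst w \<noteq> fst v}"

definition col_nbrs :: "nat \<Rightarrow> nat \<Rightarrow> nat \<times> nat \<Rightarrow> (nat \<times> nat) set" where
  "col_nbrs m n v = {w \<in> Rect n m. fst w = fst v \<and> snd w \<noteq> snd v}"

definition dom_step ::
  "(nat \<times> nat) set \<Rightarrow> nat \<Rightarrow> nat \<Rightarrow> (nat \<times> nat) set \<Rightarrow> (nat \<times> nat) set" where
  "dom_step Z m n A =
     A \<union> {v \<in> Rect n m - A. (card (row_nbrs m n v \<inter> A), card (col_nbrs m n v \<inter> A)) \<notin> Z}"

definition young_gamma :: "(nat \<times> nat) set \<Rightarrow> nat \<Rightarrow> nat \<Rightarrow> nat" where
  "young_gamma Z m n = Min {card A | A. A \<subseteq> Rect n m \<and> dom_step Z m n A = Rect n m}"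

definition convex_corners :: "(nat \<times> nat) set \<Rightarrow> (nat \<times> nat) set" where
  "convex_corners Y = {v \<in> Y. \<forall>w\<in>Y. v \<le> w \<longrightarrow> w = v}"

definition concave_corners :: "(nat \<times> nat) set \<Rightarrow> (nat \<times> nat) set" where
  "concave_corners Y = {v. v \<notin> Y \<and> (\<forall>w. w \<notin> Y \<longrightarrow> w \<le> v \<longrightarrow> w = v)}"

definition young_dual :: "nat \<Rightarrow> nat \<Rightarrow> (nat \<times> nat) set \<Rightarrow> (nat \<times> nat) set" where
  "young_dual m n Y =
     (THE D. young_diagram D \<and> D \<subseteq> Rect n m \<and>
        convex_corners D =
          {(n - a - 1, m - b - 1) | a b.
             (a, b) \<in> concave_corners Y \<and> a < n \<and> b < m})"

text \<open>
  A bipartite graph with a fixed bipartition: the two parts are understood as disjoint copies,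
  and an edge is recorded as the pair of its endpoint in the first part and its endpoint in the
  second part.
\<close>

record bigraph =
  xpart :: "nat set"
  ypart :: "nat set"
  edges :: "(nat \<times> nat) set"

definition is_bigraph :: "bigraph \<Rightarrow> bool" where
  "is_bigraph G \<longleftrightarrow> finite (xpart G) \<and> finite (ypart G) \<and> edges G \<subseteq> xpart G \<times> ypart G"

definition contains_sub :: "bigraph \<Rightarrow> bigraph \<Rightarrow> bool" where
  "contains_sub G H \<longleftrightarrow>
     (\<exists>f g. inj_on f (xpart H) \<and> f ` xpart H \<subseteq> xpart G \<and>
            inj_on g (ypart H) \<and> g ` ypart H \<subseteq> ypart G \<and>
            (\<forall>(x, y)\<in>edges H. (f x, g y) \<in> edges G))"

text \<open>
  The center \<open>u\<close> is vertex \<open>0\<close> of the first part, whose remaining vertices are the \<open>q\<close> leaves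
  attached to the center \<open>v\<close>; \<open>v\<close> is vertex \<open>0\<close> of the second part, whose remaining vertices
  are the \<open>p\<close> leaves attached to \<open>u\<close>.
\<close>

definition double_star :: "nat \<Rightarrow> nat \<Rightarrow> bigraph" where
  "double_star p q =
     \<lparr> xpart = {0..q}, ypart = {0..p},
       edges = {(0, 0)} \<union> {(0, j) | j. j \<in> {1..p}} \<union> {(i, 0) | i. i \<in> {1..q}} \<rparr>"

definition ex_bip :: "nat \<Rightarrow> nat \<Rightarrow> bigraph set \<Rightarrow> nat" where
  "ex_bip m n F =
     Max {card (edges G) | G. is_bigraph G \<and> card (xpart G) = m \<and> card (ypart G) = n \<and>
            (\<forall>H\<in>F. \<not> contains_sub G H)}"

end

theory Submission
  imports Defs
begin

text \<open>
  Complementing the edge set of a bipartite graph turns avoidance of a double star into domination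
  with a rectangular zero-set: a missing cell, i.e. an edge, must lie in a row with at least
  \<open>p = n - a\<close> or in a column with at least \<open>q = m - b\<close> chosen cells.

  For the value of the domination number, let a dominating set \<open>A\<close> have \<open>x\<close> such rows and \<open>y\<close> such
  columns. All remaining rows and columns intersect inside \<open>A\<close>, so counting by rows and by columns
  gives \<open>|A| \<ge> (m - x)(n - y) + max (p x) (q y)\<close>. If \<open>x < q\<close> or \<open>y < p\<close>, raising the small
  parameter to its threshold does not increase the relevant bound; if both are small, one counts the
  cells missing from \<open>A\<close> instead. The bound is attained by a full \<open>(m - x) \<times> (n - y)\<close> block
  together with an evenly distributed set in the complementary block.
\<close>

section \<open>Convex and concave corners, and the dual diagram\<close>

lemma down_closed_subset_Rect:
  assumes "young_diagram D" "(x, y) \<in> D"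
  shows "Rect (Suc x) (Suc y) \<subseteq> D"
  using assms unfolding young_diagram_def Rect_def
  by (auto simp: less_Suc_eq_le)

lemma below_convex_corner:
  assumes "finite D" "v \<in> D"
  obtains w where "w \<in> convex_corners D" "v \<le> w"
  using finite_has_maximal2[OF assms] unfolding convex_corners_def by blast

lemma young_diagram_Rect: "young_diagram (Rect p q)"
  unfolding young_diagram_def Rect_def by auto

lemma convex_corners_Rect:
  "convex_corners (Rect p q) = (if p = 0 \<or> q = 0 then {} else {(p - 1, q - 1)})"
proof (cases "p = 0 \<or> q = 0")
  case True
  then show ?thesis unfolding convex_corners_def Rect_def by auto
next
  case False
  let ?t = "(p - 1, q - 1)"
  have max: "w \<le> ?t" if "w \<in> Rect p q" for w
    using False that unfolding Rect_def by (cases w) auto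
  have "?t \<in> Rect p q" using False unfolding Rect_def by auto
  with max have "convex_corners (Rect p q) = {?t}"
    unfolding convex_corners_def by (auto intro: antisym)
  with False show ?thesis by simp
qed

text \<open>Supplies the uniqueness behind the \<open>THE\<close> in \<open>young_dual\<close>. In a
  finite diagram every point lies below a convex corner, so the corners determine the diagram; when
  there are no corners, there are no points either.\<close>

lemma young_diagram_eq_Rect:
  assumes D: "young_diagram D" "finite D" and c: "convex_corners D = convex_corners (Rect p q)"
  shows "D = Rect p q"
proof (cases "p = 0 \<or> q = 0")
  case True
  then show ?thesis
    using below_convex_corner[OF D(2)] c convex_corners_Rect[of p q] by (auto simp: Rect_def)
next
  case False
  then have c': "convex_corners D = {(p - 1, q - 1)}"
    using c convex_corners_Rect[of p q] by simp
  then have "(p - 1, q - 1) \<in> D"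
    unfolding convex_corners_def by blast
  from down_closed_subset_Rect[OF D(1) this] False have "Rect p q \<subseteq> D"
    by simp
  moreover have "D \<subseteq> Rect p q"
  proof
    fix v assume "v \<in> D"
    then obtain w where "w \<in> convex_corners D" "v \<le> w"
      by (rule below_convex_corner[OF D(2)])
    with c' have "v \<le> (p - 1, q - 1)" by simp
    with False show "v \<in> Rect p q"
      unfolding Rect_def by (cases v) auto
  qed
  ultimately show ?thesis by blast
qed

text \<open>The complement of \<open>Vset a b \<inter> Rect n m\<close> is the union of the
  quadrants at \<open>(a, b)\<close>, \<open>(n, 0)\<close> and \<open>(0, m)\<close>, so only these
  three points can be minimal. The range condition discards the last two.\<close>

lemma concave_corners_Vset:
  "(x, y) \<in> concave_corners (Vset a b \<inter> Rect n m) \<and> x < n \<and> y < m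
    \<longleftrightarrow> x = a \<and> y = b \<and> a < n \<and> b < m"
proof
  assume *: "(x, y) \<in> concave_corners (Vset a b \<inter> Rect n m) \<and> x < n \<and> y < m"
  then have le: "a \<le> x" "b \<le> y"
    unfolding concave_corners_def Vset_def Rect_def by auto
  moreover have "(a, b) \<notin> Vset a b \<inter> Rect n m"
    unfolding Vset_def by simp
  ultimately have "(a, b) = (x, y)"
    using * unfolding concave_corners_def by auto
  with * show "x = a \<and> y = b \<and> a < n \<and> b < m" by auto
next
  assume "x = a \<and> y = b \<and> a < n \<and> b < m"
  then show "(x, y) \<in> concave_corners (Vset a b \<inter> Rect n m) \<and> x < n \<and> y < m"
    unfolding concave_corners_def Vset_def Rect_def by auto
qed

lemma young_dual_Vset:
  "young_dual m n (Vset a b \<inter> Rect n m) = Rect (n - a) (m - b)"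
proof -
  \<comment> \<open>The reflected corner is the top corner of the rectangle. If
    \<open>a \<ge> n\<close> or \<open>b \<ge> m\<close>, no corner survives, and truncated
    subtraction makes the rectangle empty as well.\<close>
  have "{(n - x - 1, m - y - 1) | x y.
          (x, y) \<in> concave_corners (Vset a b \<inter> Rect n m) \<and> x < n \<and> y < m}
      = convex_corners (Rect (n - a) (m - b))"
    unfolding concave_corners_Vset convex_corners_Rect by auto
  moreover have "finite (Rect n m)" "Rect (n - a) (m - b) \<subseteq> Rect n m"
    unfolding Rect_def by auto
  ultimately show ?thesis
    unfolding young_dual_def
    by (intro the_equality) (simp_all add: young_diagram_Rect,
        meson finite_subset young_diagram_eq_Rect)
qed

section \<open>Domination with a rectangular zero-set\<close>

text \<open>Neighbour counts are written as sizes of relation images, so that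
  \<open>converse\<close> exchanges rows and columns and each one-sided argument serves
  twice.\<close>

definition dominating :: "nat \<Rightarrow> nat \<Rightarrow> nat \<Rightarrow> nat \<Rightarrow> (nat \<times> nat) set \<Rightarrow> bool" where
  "dominating p q m n A \<longleftrightarrow> A \<subseteq> {0..<n} \<times> {0..<m} \<and>
     (\<forall>j<n. \<forall>i<m. (j, i) \<notin> A \<longrightarrow> p \<le> card (A\<inverse> `` {i}) \<or> q \<le> card (A `` {j}))"

lemma dominating_finite: "dominating p q m n A \<Longrightarrow> finite A"
  unfolding dominating_def by (meson finite_SigmaI finite_atLeastLessThan finite_subset)

lemma dominating_converse: "dominating p q m n A \<Longrightarrow> dominating q p n m (A\<inverse>)"
  unfolding dominating_def by auto

text \<open>A vertex outside \<open>A\<close> is not counted in its own row or column of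
  \<open>A\<close>, so neighbour counts agree with section sizes. Lying outside
  \<open>Rect p q\<close> means reaching \<open>p\<close> or reaching \<open>q\<close>.\<close>

lemma dom_step_Rect_iff:
  assumes "A \<subseteq> Rect n m"
  shows "dom_step (Rect p q) m n A = Rect n m \<longleftrightarrow> dominating p q m n A"
proof -
  have r: "card (row_nbrs m n (j, i) \<inter> A) = card (A\<inverse> `` {i})" if "(j, i) \<notin> A" for j i
  proof -
    have "row_nbrs m n (j, i) \<inter> A = (\<lambda>j. (j, i)) ` (A\<inverse> `` {i})"
      using that assms unfolding row_nbrs_def by auto
    then show ?thesis by (simp add: card_image inj_on_def)
  qed
  have c: "card (col_nbrs m n (j, i) \<inter> A) = card (A `` {j})" if "(j, i) \<notin> A" for j i
  proof -
    have "col_nbrs m n (j, i) \<inter> A = Pair j ` (A `` {j})"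
      using that assms unfolding col_nbrs_def by auto
    then show ?thesis by (simp add: card_image inj_on_def)
  qed
  have "dom_step (Rect p q) m n A = Rect n m \<longleftrightarrow>
    (\<forall>j i. (j, i) \<in> Rect n m - A \<longrightarrow>
      (card (row_nbrs m n (j, i) \<inter> A), card (col_nbrs m n (j, i) \<inter> A)) \<notin> Rect p q)"
    using assms unfolding dom_step_def by (auto simp del: mem_Sigma_iff)
  also have "\<dots> \<longleftrightarrow> (\<forall>j i. (j, i) \<in> Rect n m - A \<longrightarrow>
      (card (A\<inverse> `` {i}), card (A `` {j})) \<notin> Rect p q)"
    using r c by (metis DiffD2)
  also have "\<dots> \<longleftrightarrow> dominating p q m n A"
    using assms unfolding dominating_def Rect_def by (auto simp: not_less)
  finally show ?thesis .
qed

lemma young_gamma_Rect: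
  "young_gamma (Rect p q) m n = Min {card A | A. dominating p q m n A}"
proof -
  have "A \<subseteq> Rect n m \<and> dom_step (Rect p q) m n A = Rect n m \<longleftrightarrow> dominating p q m n A" for A
    using dom_step_Rect_iff[of A n m p q] by (auto simp: dominating_def Rect_def)
  then show ?thesis unfolding young_gamma_def by simp
qed

lemma finite_dominating_cards: "finite {card A | A. dominating p q m n A}"
proof -
  have "{card A | A. dominating p q m n A} \<subseteq> card ` Pow ({0..<n} \<times> {0..<m})"
    unfolding dominating_def by auto
  then show ?thesis by (rule finite_subset) simp
qed

lemma young_gamma_Rect_le: "dominating p q m n A \<Longrightarrow> young_gamma (Rect p q) m n \<le> card A"
  unfolding young_gamma_Rect by (rule Min_le[OF finite_dominating_cards]) auto

lemma young_gamma_Rect_attained: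
  obtains A where "dominating p q m n A" "card A = young_gamma (Rect p q) m n"
proof -
  \<comment> \<open>The full grid dominates vacuously, so the minimum is over a nonempty
    set.\<close>
  have "dominating p q m n ({0..<n} \<times> {0..<m})"
    unfolding dominating_def by auto
  then have "{card A | A. dominating p q m n A} \<noteq> {}" by blast
  from Min_in[OF finite_dominating_cards this] show ?thesis
    using that unfolding young_gamma_Rect by force
qed

section \<open>Double stars and complementation\<close>

text \<open>The degree form of avoiding the double star: an edge can be its central edge exactly if
  one end has \<open>a\<close> neighbours and the other \<open>b\<close> neighbours besides each
  other.\<close>

definition star_free :: "nat \<Rightarrow> nat \<Rightarrow> ('a \<times> 'b) set \<Rightarrow> bool" where
  "star_free a b E \<longleftrightarrow> (\<forall>(x, y)\<in>E. card (E `` {x}) \<le> a \<or> card (E\<inverse> `` {y}) \<le> b)"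

text \<open>Builds one half of an embedding: index 0 is forced to be the opposite center, the other
  \<open>k\<close> indices are leaves.\<close>

lemma inj_enumeration_from:
  assumes "finite S" "y \<in> S" "k < card S"
  obtains g :: "nat \<Rightarrow> 'a" where "inj_on g {0..k}" "g 0 = y" "g ` {0..k} \<subseteq> S"
proof -
  obtain h where h: "bij_betw h {0..<card (S - {y})} (S - {y})"
    using ex_bij_betw_nat_finite assms(1) by blast
  have card: "k \<le> card (S - {y})" using assms by simp
  define g where "g = case_nat y h"
  have hS: "h i \<in> S - {y}" if "i < k" for i
    using h card that by (auto simp: bij_betw_def)
  have inj: "inj_on h {0..<k}"
    using h card by (auto simp: bij_betw_def intro: inj_on_subset)
  have "inj_on g {0..k}"
  proof (rule inj_onI)
    fix i j assume "i \<in> {0..k}" "j \<in> {0..k}" "g i = g j"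
    then show "i = j"
      using hS inj unfolding g_def
      by (cases i; cases j) (auto simp: inj_on_def Suc_le_eq dest: sym)
  qed
  moreover have "g 0 = y" by (simp add: g_def)
  moreover have "g i \<in> S" if "i \<le> k" for i
    using hS that assms(2) unfolding g_def by (cases i) auto
  ultimately show ?thesis using that by (metis atLeastAtMost_iff image_subsetI)
qed

text \<open>The leaves of the two centers lie in opposite parts and cannot collide, so they can be
  chosen independently and only the two degrees matter.\<close>

lemma contains_double_star_iff:
  assumes G: "is_bigraph G"
  shows "contains_sub G (double_star a b) \<longleftrightarrow> \<not> star_free a b (edges G)"
proof -
  let ?E = "edges G"
  have fin: "finite ?E"
    using G unfolding is_bigraph_def by (meson finite_SigmaI finite_subset)
  then have fin': "finite (?E `` {x})" "finite (?E\<inverse> `` {y})" for x y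
    by (simp_all add: finite_Image)
  show ?thesis
  proof
    assume "contains_sub G (double_star a b)"
    then obtain f g where f: "inj_on f {0..b}" and g: "inj_on g {0..a}"
      and e: "(f 0, g 0) \<in> ?E" "\<And>j. j \<in> {1..a} \<Longrightarrow> (f 0, g j) \<in> ?E"
        "\<And>i. i \<in> {1..b} \<Longrightarrow> (f i, g 0) \<in> ?E"
      unfolding contains_sub_def double_star_def by fastforce
    have "(f 0, g j) \<in> ?E" if "j \<le> a" for j using e that by (cases j) auto
    then have "g ` {0..a} \<subseteq> ?E `` {f 0}" by auto
    from card_mono[OF fin'(1) this] have 1: "a < card (?E `` {f 0})"
      using card_image[OF g] by simp
    have "(f i, g 0) \<in> ?E" if "i \<le> b" for i using e that by (cases i) auto
    then have "f ` {0..b} \<subseteq> ?E\<inverse> `` {g 0}" by auto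
    from card_mono[OF fin'(2) this] have 2: "b < card (?E\<inverse> `` {g 0})"
      using card_image[OF f] by simp
    from 1 2 e(1) show "\<not> star_free a b ?E"
      unfolding star_free_def by fastforce
  next
    assume "\<not> star_free a b ?E"
    then obtain x y where xy: "(x, y) \<in> ?E" "a < card (?E `` {x})" "b < card (?E\<inverse> `` {y})"
      unfolding star_free_def by fastforce
    obtain g where g: "inj_on g {0..a}" "g 0 = y" "g ` {0..a} \<subseteq> ?E `` {x}"
      using inj_enumeration_from[OF fin'(1) _ xy(2)] xy(1) by (metis ImageI singletonI)
    obtain f where f: "inj_on f {0..b}" "f 0 = x" "f ` {0..b} \<subseteq> ?E\<inverse> `` {y}"
      using inj_enumeration_from[OF fin'(2) _ xy(3)] xy(1)
      by (metis ImageI converseI singletonI)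
    have "?E \<subseteq> xpart G \<times> ypart G" using G unfolding is_bigraph_def by blast
    with f g have "f ` {0..b} \<subseteq> xpart G" "g ` {0..a} \<subseteq> ypart G" by blast+
    moreover have "(f 0, g j) \<in> ?E" if "j \<le> a" for j using g(3) f(2) that by (auto simp: image_subset_iff)
    moreover have "(f i, g 0) \<in> ?E" if "i \<le> b" for i using f(3) g(2) that by (auto simp: image_subset_iff)
    ultimately show "contains_sub G (double_star a b)"
      using f(1) g(1) unfolding contains_sub_def double_star_def
      by (intro exI[of _ f] exI[of _ g]) auto
  qed
qed

text \<open>\<open>ex_bip\<close> ranges over arbitrary vertex sets, while domination lives on a
  fixed grid; this permits relabelling the vertices.\<close>

lemma star_free_map_prod:
  assumes u: "inj_on u X" and w: "inj_on w Y" and E: "E \<subseteq> X \<times> Y" and "star_free a b E"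
  shows "star_free a b (map_prod u w ` E)"
proof -
  have "card ((map_prod u w ` E) `` {u x}) = card (E `` {x})" if "x \<in> X" for x
  proof -
    have "(map_prod u w ` E) `` {u x} = w ` (E `` {x})"
      using that E inj_onD[OF u] by (force simp: image_iff)
    moreover have "inj_on w (E `` {x})" using w E by (auto intro: inj_on_subset)
    ultimately show ?thesis by (simp add: card_image)
  qed
  moreover have "card ((map_prod u w ` E)\<inverse> `` {w y}) = card (E\<inverse> `` {y})" if "y \<in> Y" for y
  proof -
    have "(map_prod u w ` E)\<inverse> `` {w y} = u ` (E\<inverse> `` {y})"
      using that E inj_onD[OF w] by (force simp: image_iff)
    moreover have "inj_on u (E\<inverse> `` {y})" using u E by (auto intro: inj_on_subset)
    ultimately show ?thesis by (simp add: card_image)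
  qed
  ultimately show ?thesis
    using assms(4) E unfolding star_free_def by fastforce
qed

text \<open>A row of the complement has \<open>n\<close> minus the degree many cells, so reaching
  \<open>n - a\<close> bounds the degree by \<open>a\<close>; columns are analogous. The converse
  appears because grid points list the column first and edges list the row vertex first.\<close>

lemma star_free_iff_dominating_complement:
  assumes "a \<le> n" "b \<le> m" and E: "E \<subseteq> {0..<m} \<times> {0..<n}"
  shows "star_free a b E \<longleftrightarrow> dominating (n - a) (m - b) m n ({0..<n} \<times> {0..<m} - E\<inverse>)"
proof -
  let ?A = "{0..<n} \<times> {0..<m} - E\<inverse>"
  have r: "card (?A\<inverse> `` {i}) = n - card (E `` {i})" "card (E `` {i}) \<le> n" if "i < m" for i
  proof -
    have "?A\<inverse> `` {i} = {0..<n} - E `` {i}" "E `` {i} \<subseteq> {0..<n}" using that E by auto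
    then show "card (?A\<inverse> `` {i}) = n - card (E `` {i})" "card (E `` {i}) \<le> n"
      using card_mono[of "{0..<n}" "E `` {i}"]
      by (simp_all add: card_Diff_subset finite_subset)
  qed
  have c: "card (?A `` {j}) = m - card (E\<inverse> `` {j})" "card (E\<inverse> `` {j}) \<le> m" if "j < n" for j
  proof -
    have "?A `` {j} = {0..<m} - E\<inverse> `` {j}" "E\<inverse> `` {j} \<subseteq> {0..<m}" using that E by auto
    then show "card (?A `` {j}) = m - card (E\<inverse> `` {j})" "card (E\<inverse> `` {j}) \<le> m"
      using card_mono[of "{0..<m}" "E\<inverse> `` {j}"]
      by (simp_all add: card_Diff_subset finite_subset)
  qed
  have *: "(n - a \<le> card (?A\<inverse> `` {i}) \<or> m - b \<le> card (?A `` {j}))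
      \<longleftrightarrow> (card (E `` {i}) \<le> a \<or> card (E\<inverse> `` {j}) \<le> b)" if "i < m" "j < n" for i j
    using r[OF that(1)] c[OF that(2)] assms(1,2) by auto
  have "dominating (n - a) (m - b) m n ?A \<longleftrightarrow>
      (\<forall>j<n. \<forall>i<m. (i, j) \<in> E \<longrightarrow> n - a \<le> card (?A\<inverse> `` {i}) \<or> m - b \<le> card (?A `` {j}))"
    unfolding dominating_def by (simp only: Diff_iff mem_Sigma_iff converse_iff) auto
  also have "\<dots> \<longleftrightarrow> (\<forall>j<n. \<forall>i<m. (i, j) \<in> E \<longrightarrow> card (E `` {i}) \<le> a \<or> card (E\<inverse> `` {j}) \<le> b)"
    using * by blast
  also have "\<dots> \<longleftrightarrow> star_free a b E"
    using E unfolding star_free_def by fastforce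
  finally show ?thesis by simp
qed

lemma card_complement_converse:
  assumes "E \<subseteq> {0..<m} \<times> {0..<n :: nat}"
  shows "card E + card ({0..<n} \<times> {0..<m} - E\<inverse>) = m * n"
proof -
  have "E\<inverse> \<subseteq> {0..<n} \<times> {0..<m}" using assms by auto
  moreover from this have "finite (E\<inverse>)" by (rule finite_subset) simp
  moreover have "card (E\<inverse>) \<le> card ({0..<n} \<times> {0..<m})"
    using calculation by (intro card_mono) auto
  ultimately show ?thesis by (simp add: card_Diff_subset mult.commute)
qed

text \<open>Stated as a sum to avoid truncated subtraction. Relabelling and complementing any
  admissible graph gives a dominating set; the complement of a minimum dominating set attains the
  bound.\<close>

lemma ex_bip_double_star:
  assumes "a \<le> n" "b \<le> m"
  shows "ex_bip m n {double_star a b} + young_gamma (Rect (n - a) (m - b)) m n = m * n"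
proof -
  let ?g = "young_gamma (Rect (n - a) (m - b)) m n"
  let ?S = "{card (edges G) | G. is_bigraph G \<and> card (xpart G) = m \<and> card (ypart G) = n \<and>
            (\<forall>H\<in>{double_star a b}. \<not> contains_sub G H)}"
  have upper: "k + ?g \<le> m * n" if k: "k \<in> ?S" for k
  proof -
    obtain G where G: "k = card (edges G)" "is_bigraph G" "card (xpart G) = m"
        "card (ypart G) = n" "star_free a b (edges G)"
      using k by (auto simp: contains_double_star_iff)
    then have fin: "finite (xpart G)" "finite (ypart G)"
      and E: "edges G \<subseteq> xpart G \<times> ypart G" by (auto simp: is_bigraph_def)
    obtain u w where u: "bij_betw u (xpart G) {0..<m}" and w: "bij_betw w (ypart G) {0..<n}"
      using ex_bij_betw_finite_nat fin G(3,4) by metis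
    let ?E = "map_prod u w ` edges G"
    have sub: "?E \<subseteq> {0..<m} \<times> {0..<n}"
      using u w E by (fastforce simp: bij_betw_def)
    have "inj_on (map_prod u w) (edges G)"
      using inj_on_subset[OF map_prod_inj_on E] u w by (auto simp: bij_betw_def)
    then have "card ?E = k" using G(1) by (simp add: card_image)
    moreover have "star_free a b ?E"
      using u w E G(5) by (intro star_free_map_prod) (auto simp: bij_betw_def)
    ultimately show ?thesis
      using young_gamma_Rect_le star_free_iff_dominating_complement[OF assms sub]
        card_complement_converse[OF sub] by fastforce
  qed
  obtain A where A: "dominating (n - a) (m - b) m n A" "card A = ?g"
    by (rule young_gamma_Rect_attained)
  let ?E = "{0..<m} \<times> {0..<n} - A\<inverse>"
  have sub: "?E \<subseteq> {0..<m} \<times> {0..<n}" by blast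
  have "A \<subseteq> {0..<n} \<times> {0..<m}"
    using A(1) unfolding dominating_def by blast
  then have compl: "{0..<n} \<times> {0..<m} - ?E\<inverse> = A" by auto
  have "card ?E + ?g = m * n"
    using card_complement_converse[OF sub] unfolding compl A(2) .
  moreover have "card ?E \<in> ?S"
  proof -
    let ?G = "\<lparr> xpart = {0..<m}, ypart = {0..<n}, edges = ?E \<rparr>"
    have "is_bigraph ?G" unfolding is_bigraph_def by auto
    moreover have "star_free a b ?E"
      using A(1) star_free_iff_dominating_complement[OF assms sub] unfolding compl by blast
    ultimately have "is_bigraph ?G \<and> card (xpart ?G) = m \<and> card (ypart ?G) = n \<and>
        (\<forall>H\<in>{double_star a b}. \<not> contains_sub ?G H)"
      by (simp add: contains_double_star_iff)
    then show ?thesis by force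
  qed
  \<comment> \<open>There are infinitely many graphs, since vertex names are free, but their edge
    counts are bounded.\<close>
  moreover have "finite ?S"
    by (rule finite_subset[of _ "{..m * n}"]) (use upper in fastforce, simp)
  moreover have "k \<le> card ?E" if "k \<in> ?S" for k
    using upper[OF that] \<open>card ?E + ?g = m * n\<close> by linarith
  ultimately have "Max ?S = card ?E" by (intro Max_eqI)
  with \<open>card ?E + ?g = m * n\<close> show ?thesis unfolding ex_bip_def by simp
qed

section \<open>Lower bounds for dominating sets\<close>

lemma card_eq_sum_sections:
  assumes "finite A" "A \<subseteq> {0..<n :: nat} \<times> UNIV"
  shows "card A = (\<Sum>j<n. card (A `` {j}))"
proof -
  have "A = Sigma {..<n} (\<lambda>j. A `` {j})" using assms by auto
  then have "card A = card (Sigma {..<n} (\<lambda>j. A `` {j}))" by simp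
  also have "\<dots> = (\<Sum>j<n. card (A `` {j}))"
    using assms by (subst card_SigmaI) (auto simp: finite_Image)
  finally show ?thesis .
qed

text \<open>Counts columns when applied to \<open>A\<close> and rows when applied to its
  converse.\<close>

definition heavy :: "nat \<Rightarrow> nat \<Rightarrow> (nat \<times> nat) set \<Rightarrow> nat set" where
  "heavy n q A = {j. j < n \<and> q \<le> card (A `` {j})}"

lemma finite_heavy: "finite (heavy n q A)" and card_heavy_le: "card (heavy n q A) \<le> n"
  using card_mono[of "{..<n}" "heavy n q A"] finite_subset[of "heavy n q A" "{..<n}"]
  by (auto simp: heavy_def)

text \<open>A cell where a light column meets a light row must belong to \<open>A\<close>. Hence
  each light column has at least \<open>m - x\<close> cells, and each heavy one at least
  \<open>q\<close>.\<close>

lemma dominating_lower_bound: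
  assumes A: "dominating p q m n A"
  defines "x \<equiv> card (heavy m p (A\<inverse>))" and "y \<equiv> card (heavy n q A)"
  shows "(m - x) * (n - y) + q * y \<le> card A"
proof -
  let ?C = "heavy n q A" and ?R = "heavy m p (A\<inverse>)"
  have fin: "finite A" and sub: "A \<subseteq> {0..<n} \<times> {0..<m}"
    using dominating_finite[OF A] A unfolding dominating_def by auto
  have light: "m - x \<le> card (A `` {j})" if "j \<in> {..<n} - ?C" for j
  proof -
    have "{0..<m} - ?R \<subseteq> A `` {j}"
      using A that unfolding dominating_def heavy_def by auto
    then have "card ({0..<m} - ?R) \<le> card (A `` {j})"
      using fin by (intro card_mono) (auto simp: finite_Image)
    moreover have "card ({0..<m} - ?R) = m - x"
      unfolding x_def by (subst card_Diff_subset) (auto simp: heavy_def)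
    ultimately show ?thesis by simp
  qed
  have "?C \<subseteq> {..<n}" unfolding heavy_def by auto
  then have "card A = (\<Sum>j\<in>{..<n} - ?C. card (A `` {j})) + (\<Sum>j\<in>?C. card (A `` {j}))"
    using card_eq_sum_sections[OF fin] sub sum.subset_diff[of ?C "{..<n}"] by fastforce
  moreover have "(n - y) * (m - x) \<le> (\<Sum>j\<in>{..<n} - ?C. card (A `` {j}))"
  proof -
    have "card ({..<n} - ?C) = n - y"
      unfolding y_def using \<open>?C \<subseteq> {..<n}\<close> by (simp add: card_Diff_subset finite_heavy)
    then show ?thesis
      using sum_bounded_below[of "{..<n} - ?C" "m - x", OF light] by simp
  qed
  moreover have "y * q \<le> (\<Sum>j\<in>?C. card (A `` {j}))"
    unfolding y_def using sum_bounded_below[of ?C q "\<lambda>j. card (A `` {j})"]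
    by (simp add: heavy_def)
  ultimately show ?thesis by (simp add: mult.commute)
qed

lemma card_missing_heavy:
  assumes "A \<subseteq> {0..<n} \<times> {0..<m}"
  shows "card ((heavy n q A \<times> {0..<m}) - A) \<le> card (heavy n q A) * (m - q)"
proof -
  have "(heavy n q A \<times> {0..<m}) - A = Sigma (heavy n q A) (\<lambda>j. {0..<m} - A `` {j})"
    by auto
  then have "card ((heavy n q A \<times> {0..<m}) - A) = (\<Sum>j\<in>heavy n q A. card ({0..<m} - A `` {j}))"
    by (simp add: card_SigmaI finite_heavy)
  also have "\<dots> \<le> (\<Sum>j\<in>heavy n q A. m - q)"
  proof (rule sum_mono)
    fix j assume j: "j \<in> heavy n q A"
    have "A `` {j} \<subseteq> {0..<m}" using assms by auto
    then have "card ({0..<m} - A `` {j}) = m - card (A `` {j})"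
      by (simp add: card_Diff_subset finite_subset)
    with j show "card ({0..<m} - A `` {j}) \<le> m - q" by (auto simp: heavy_def)
  qed
  finally show ?thesis by simp
qed

text \<open>Every missing cell lies in a heavy column, which misses at most \<open>m - q\<close>
  cells, or in a heavy row, which misses at most \<open>n - p\<close>.\<close>

lemma dominating_missing_bound:
  assumes A: "dominating p q m n A"
  defines "x \<equiv> card (heavy m p (A\<inverse>))" and "y \<equiv> card (heavy n q A)"
  shows "m * n \<le> card A + x * (n - p) + y * (m - q)"
proof -
  let ?L = "(heavy n q A \<times> {0..<m}) - A" and ?M = "(heavy m p (A\<inverse>) \<times> {0..<n}) - A\<inverse>"
  have fin: "finite A" and sub: "A \<subseteq> {0..<n} \<times> {0..<m}" and sub': "A\<inverse> \<subseteq> {0..<m} \<times> {0..<n}"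
    using dominating_finite[OF A] A unfolding dominating_def by auto
  have finLM: "finite ?L" "finite (?M\<inverse>)" by (auto simp: finite_heavy)
  have "{0..<n} \<times> {0..<m} \<subseteq> A \<union> (?L \<union> ?M\<inverse>)"
    using A unfolding dominating_def heavy_def by auto
  then have "card ({0..<n} \<times> {0..<m}) \<le> card (A \<union> (?L \<union> ?M\<inverse>))"
    using fin finLM by (intro card_mono) auto
  also have "\<dots> \<le> card A + (card ?L + card (?M\<inverse>))"
    by (meson add_left_mono card_Un_le order_trans)
  also have "\<dots> \<le> card A + (y * (m - q) + x * (n - p))"
    using card_missing_heavy[OF sub] card_missing_heavy[OF sub']
    unfolding x_def y_def by (simp add: add_mono)
  finally show ?thesis by (simp add: mult.commute)
qed

lemma dominating_lower_bound_range:
  assumes A: "dominating p q m n A" and "p \<le> n" "q \<le> m"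
  obtains x y where "q \<le> x" "x \<le> m" "p \<le> y" "y \<le> n"
    "(m - x) * (n - y) + max (p * x) (q * y) \<le> card A"
proof -
  define x where "x = card (heavy m p (A\<inverse>))"
  define y where "y = card (heavy n q A)"
  have le: "x \<le> m" "y \<le> n" by (simp_all add: x_def y_def card_heavy_le)
  have cols: "(m - x) * (n - y) + q * y \<le> card A"
    unfolding x_def y_def by (rule dominating_lower_bound[OF A])
  have rows: "(m - x) * (n - y) + p * x \<le> card A"
    using dominating_lower_bound[OF dominating_converse[OF A]]
    unfolding x_def y_def by (simp add: mult.commute)
  consider "q \<le> x" "p \<le> y" | "x \<le> q" "p \<le> y" | "q \<le> x" "y \<le> p" | "x \<le> q" "y \<le> p"
    by linarith
  then show ?thesis
  proof cases
    case 1
    then show ?thesis using that[of x y] le rows cols by (simp add: max_def)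
  next
    case 2
    \<comment> \<open>After \<open>x\<close> is raised to \<open>q\<close>, the maximum is
      \<open>q * y\<close>, so the count by columns suffices; the next case is the
      transpose.\<close>
    then have "(m - q) * (n - y) \<le> (m - x) * (n - y)" "p * q \<le> q * y"
      by (simp_all add: mult.commute diff_le_mono2)
    then have "(m - q) * (n - y) + max (p * q) (q * y) \<le> card A"
      using cols by linarith
    then show ?thesis using that[of q y] 2 le assms by blast
  next
    case 3
    then have "(m - x) * (n - p) \<le> (m - x) * (n - y)" "q * p \<le> p * x"
      by (simp_all add: mult.commute diff_le_mono2)
    then have "(m - x) * (n - p) + max (p * x) (q * p) \<le> card A"
      using rows by linarith
    then show ?thesis using that[of x p] 3 le assms by blast
  next
    case 4
    \<comment> \<open>The counts by rows and columns alone are too weak here.\<close>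
    have "m * n \<le> card A + x * (n - p) + y * (m - q)"
      unfolding x_def y_def by (rule dominating_missing_bound[OF A])
    also have "\<dots> \<le> card A + q * (n - p) + p * (m - q)"
      using 4 by (intro add_mono mult_right_mono) auto
    finally have "m * n \<le> card A + q * (n - p) + p * (m - q)" .
    \<comment> \<open>Without truncated subtraction the bound reads
      \<open>d * c + p * q \<le> card A\<close>, which is the formula at \<open>(q, p)\<close>,
      where both arguments of \<open>max\<close> coincide.\<close>
    moreover obtain c d where "n = p + c" "m = q + d"
      using assms(2,3) by (auto simp: le_iff_add)
    ultimately show ?thesis using that[of q p] assms(2,3) by (simp add: algebra_simps)
  qed
qed

section \<open>Construction of optimal dominating sets\<close>

text \<open>
  The block is filled row by row with \<open>p\<close> cells each, the columns being taken cyclically, so that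
  every column is visited at least \<open>q\<close> times.
\<close>

lemma cyclic_block:
  assumes "0 < p" "p \<le> y" "q * y \<le> p * x"
  obtains B where "B \<subseteq> {0..<y} \<times> {0..<x}" "card B \<le> p * x"
    "\<And>i. i < x \<Longrightarrow> p \<le> card (B\<inverse> `` {i})" "\<And>j. j < y \<Longrightarrow> q \<le> card (B `` {j})"
proof -
  define B where "B = (\<lambda>k. (k mod y, k div p)) ` {0..<p * x}"
  have finB: "finite B" by (simp add: B_def)
  have "B \<subseteq> {0..<y} \<times> {0..<x}"
    using assms unfolding B_def by (auto simp: less_mult_imp_div_less mult.commute)
  moreover have "card B \<le> p * x"
    using card_image_le[of "{0..<p * x}"] unfolding B_def by fastforce
  moreover have "p \<le> card (B\<inverse> `` {i})" if i: "i < x" for i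
  proof -
    \<comment> \<open>Row \<open>i\<close> receives the \<open>p\<close> consecutive indices from
      \<open>p * i\<close> on; they stay distinct modulo \<open>y\<close> because
      \<open>p \<le> y\<close>.\<close>
    let ?h = "\<lambda>s. (p * i + s) mod y"
    have "inj_on ?h {0..<p}"
    proof (rule linorder_inj_onI')
      fix s t assume st: "s \<in> {0..<p}" "t \<in> {0..<p}" "s < t"
      show "?h s \<noteq> ?h t"
      proof
        assume "?h s = ?h t"
        then have "y dvd t - s"
          using mod_eq_dvd_iff_nat[of "p * i + s" "p * i + t" y] st by simp
        with st assms show False using dvd_imp_le[of y "t - s"] by auto
      qed
    qed
    moreover have "?h ` {0..<p} \<subseteq> B\<inverse> `` {i}"
    proof
      fix j assume "j \<in> ?h ` {0..<p}"
      then obtain s where s: "s < p" "j = ?h s" by auto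
      have "p * i + s < p * Suc i" using s by simp
      also have "\<dots> \<le> p * x" using i by (intro mult_le_mono2) auto
      finally have "p * i + s \<in> {0..<p * x}" by simp
      moreover have "(p * i + s) div p = i" using s by simp
      ultimately show "j \<in> B\<inverse> `` {i}" unfolding B_def using s(2) by force
    qed
    ultimately show ?thesis
      using card_inj_on_le[of ?h "{0..<p}" "B\<inverse> `` {i}"] finB by (simp add: finite_Image)
  qed
  moreover have "q \<le> card (B `` {j})" if j: "j < y" for j
  proof -
    \<comment> \<open>Column \<open>j\<close> receives the indices \<open>j + t * y\<close>. Those
      with \<open>t < q\<close> are available since \<open>q * y \<le> p * x\<close>, and steps of
      length \<open>y \<ge> p\<close> always reach a new row.\<close>
    let ?h = "\<lambda>t. (j + t * y) div p"
    have "inj_on ?h {0..<q}"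
    proof (rule linorder_inj_onI')
      fix s t assume st: "s \<in> {0..<q}" "t \<in> {0..<q}" "s < t"
      then have "s * y + y \<le> t * y" using mult_le_mono1[of "Suc s" t y] by simp
      with assms have "j + s * y + p \<le> j + t * y" by linarith
      then have "(j + s * y + p) div p \<le> ?h t" by (rule div_le_mono)
      moreover have "(j + s * y + p) div p = ?h s + 1"
        using assms(1) by (intro div_add_self2) simp
      ultimately show "?h s \<noteq> ?h t" by linarith
    qed
    moreover have "?h ` {0..<q} \<subseteq> B `` {j}"
    proof
      fix i assume "i \<in> ?h ` {0..<q}"
      then obtain t where t: "t < q" "i = ?h t" by auto
      have "j + t * y < Suc t * y" using j by simp
      also have "\<dots> \<le> q * y" using t by (intro mult_le_mono1) auto
      also have "\<dots> \<le> p * x" by fact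
      finally have "j + t * y \<in> {0..<p * x}" by simp
      moreover have "(j + t * y) mod y = j" using j by simp
      ultimately show "i \<in> B `` {j}" unfolding B_def using t(2) by force
    qed
    ultimately show ?thesis
      using card_inj_on_le[of ?h "{0..<q}" "B `` {j}"] finB by (simp add: finite_Image)
  qed
  ultimately show ?thesis by (rule that)
qed

text \<open>The cyclic block makes the first \<open>x\<close> rows and the first \<open>y\<close>
  columns heavy. The only cells outside these rows and columns form the full block, so every missing
  cell is dominated.\<close>

lemma dominating_construction:
  assumes "0 < p" "p \<le> y" "y \<le> n" "x \<le> m" "q * y \<le> p * x"
  obtains A where "dominating p q m n A" "card A \<le> (m - x) * (n - y) + p * x"
proof -
  obtain B where B: "B \<subseteq> {0..<y} \<times> {0..<x}" "card B \<le> p * x"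
    "\<And>i. i < x \<Longrightarrow> p \<le> card (B\<inverse> `` {i})" "\<And>j. j < y \<Longrightarrow> q \<le> card (B `` {j})"
    using cyclic_block[of p y q x] assms by metis
  let ?A = "B \<union> {y..<n} \<times> {x..<m}"
  have fin: "finite ?A" using B(1) by (auto dest: finite_subset)
  have "p \<le> card (?A\<inverse> `` {i})" if "i < x" for i
    using B(3)[OF that] card_mono[of "?A\<inverse> `` {i}" "B\<inverse> `` {i}"] fin
    by (force simp: finite_Image)
  moreover have "q \<le> card (?A `` {j})" if "j < y" for j
    using B(4)[OF that] card_mono[of "?A `` {j}" "B `` {j}"] fin
    by (force simp: finite_Image)
  ultimately have "dominating p q m n ?A"
    using B(1) assms unfolding dominating_def by (force simp: not_less)
  moreover have "card ?A \<le> (m - x) * (n - y) + p * x"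
    using card_Un_le[of B "{y..<n} \<times> {x..<m}"] B(2) by (simp add: mult.commute)
  ultimately show ?thesis by (rule that)
qed

text \<open>The larger of \<open>p * x\<close> and \<open>q * y\<close> decides whether the block is
  filled by rows or, through the converse, by columns.\<close>

lemma young_gamma_Rect_upper:
  assumes "0 < p" "0 < q" "q \<le> x" "x \<le> m" "p \<le> y" "y \<le> n"
  shows "young_gamma (Rect p q) m n \<le> (m - x) * (n - y) + max (p * x) (q * y)"
proof (cases "q * y \<le> p * x")
  case True
  obtain A where "dominating p q m n A" "card A \<le> (m - x) * (n - y) + p * x"
    using dominating_construction[of p y n x m q] assms True by blast
  with young_gamma_Rect_le show ?thesis using True by (fastforce simp: max_def)
next
  case False
  obtain A where A: "dominating q p n m A" "card A \<le> (n - y) * (m - x) + q * y"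
    using dominating_construction[of q x m y n p] assms False by (metis nat_le_linear)
  have "young_gamma (Rect p q) m n \<le> card (A\<inverse>)"
    using dominating_converse[OF A(1)] by (rule young_gamma_Rect_le)
  also have "\<dots> \<le> (m - x) * (n - y) + max (p * x) (q * y)"
    using A(2) False by (simp add: mult.commute)
  finally show ?thesis .
qed

theorem corollary3p3:
  fixes m n a b :: nat
  assumes "m \<ge> 1" and "n \<ge> 1" and "a \<le> n" and "b \<le> m"
  shows "young_dual m n (Vset a b \<inter> Rect n m) = Rect (n - a) (m - b) \<and>
         int (ex_bip m n {double_star a b})
           = int m * int n - int (young_gamma (Rect (n - a) (m - b)) m n) \<and>
         (a \<le> n - 1 \<and> b \<le> m - 1 \<longrightarrow>
           int (young_gamma (Rect (n - a) (m - b)) m n)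
             = Min {(int m - x) * (int n - y)
                      + max ((int n - int a) * x) ((int m - int b) * y) | x y :: int.
                    int m - int b \<le> x \<and> x \<le> int m \<and> int n - int a \<le> y \<and> y \<le> int n})"
proof (intro conjI impI)
  show "young_dual m n (Vset a b \<inter> Rect n m) = Rect (n - a) (m - b)"
    by (rule young_dual_Vset)
  show "int (ex_bip m n {double_star a b})
      = int m * int n - int (young_gamma (Rect (n - a) (m - b)) m n)"
    using ex_bip_double_star[OF assms(3,4)] by (metis add_diff_cancel_right' of_nat_add of_nat_mult)
next
  assume ab: "a \<le> n - 1 \<and> b \<le> m - 1"
  define p q where "p = n - a" and "q = m - b"
  \<comment> \<open>Positivity is where the bounds on \<open>a\<close> and \<open>b\<close> enter:
    the cyclic filling divides by \<open>p\<close>, and its transpose by \<open>q\<close>.\<close>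
  have pq: "0 < p" "0 < q" "p \<le> n" "q \<le> m" "int n - int a = int p" "int m - int b = int q"
    using ab assms by (auto simp: p_def q_def)
  let ?f = "\<lambda>x y :: int. (int m - x) * (int n - y) + max (int p * x) (int q * y)"
  let ?S = "{?f x y | x y. int q \<le> x \<and> x \<le> int m \<and> int p \<le> y \<and> y \<le> int n}"
  \<comment> \<open>Within the range the natural subtractions are exact, so the integer and natural
    formulas agree.\<close>
  have f_int: "?f (int x) (int y) = int ((m - x) * (n - y) + max (p * x) (q * y))"
    if "x \<le> m" "y \<le> n" for x y
    using that by (simp add: of_nat_diff of_nat_max)
  have "Min ?S = int (young_gamma (Rect p q) m n)"
  proof (rule antisym)
    have fin: "finite ?S"
      by (rule finite_subset[of _ "(\<lambda>(x, y). ?f x y) ` ({int q..int m} \<times> {int p..int n})"]) auto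
    obtain A where A: "dominating p q m n A" "card A = young_gamma (Rect p q) m n"
      by (rule young_gamma_Rect_attained)
    obtain x y where xy: "q \<le> x" "x \<le> m" "p \<le> y" "y \<le> n"
      "(m - x) * (n - y) + max (p * x) (q * y) \<le> young_gamma (Rect p q) m n"
      using dominating_lower_bound_range[OF A(1) pq(3,4)] A(2) by metis
    then have "?f (int x) (int y) \<in> ?S" by fastforce
    then have "Min ?S \<le> ?f (int x) (int y)" by (rule Min_le[OF fin])
    also have "\<dots> \<le> int (young_gamma (Rect p q) m n)"
      unfolding f_int[OF xy(2,4)] using xy(5) by linarith
    finally show "Min ?S \<le> int (young_gamma (Rect p q) m n)" .
    have "int (young_gamma (Rect p q) m n) \<le> z" if "z \<in> ?S" for z
    proof -
      obtain x' y' where z: "z = ?f x' y'" "int q \<le> x'" "x' \<le> int m" "int p \<le> y'" "y' \<le> int n"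
        using \<open>z \<in> ?S\<close> by blast
      \<comment> \<open>The lower limits \<open>q\<close> and \<open>p\<close> make the integer
        parameters nonnegative, so they come from naturals.\<close>
      obtain x y where xy': "x' = int x" "y' = int y"
        using z by (metis of_nat_0_le_iff order_trans nonneg_int_cases)
      with z have xy: "q \<le> x" "x \<le> m" "p \<le> y" "y \<le> n" by auto
      show ?thesis
        unfolding z(1) xy' f_int[OF xy(2,4)]
        using young_gamma_Rect_upper[OF pq(1,2) xy] by linarith
    qed
    moreover have "?S \<noteq> {}" using \<open>?f (int x) (int y) \<in> ?S\<close> by blast
    ultimately show "int (young_gamma (Rect p q) m n) \<le> Min ?S"
      using fin by simp
  qed
  then show "int (young_gamma (Rect (n - a) (m - b)) m n)
      = Min {(int m - x) * (int n - y)
          + max ((int n - int a) * x) ((int m - int b) * y) | x y :: int.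
        int m - int b \<le> x \<and> x \<le> int m \<and> int n - int a \<le> y \<and> y \<le> int n}"
    unfolding pq(5,6) p_def[symmetric] q_def[symmetric] by simp
qed

end
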